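(* Let $(S,+,\circ)$ be a dual weak brace in which the Clifford semigroup $(S,+)$ is commutative. Then $\mathcal{D}_r(S)$ is a two-sided dual weak subbrace of $S$.
   Context: An inverse semigroup is a semigroup in which every element $a$ has a unique inverse $a'$ satisfying $a=aa'a$ and $a'=a'aa'$; it is a Clifford semigroup if moreover $aa'=a'a$ for every $a$. A weak (left) brace $(S,+,\circ)$ is a set $S$ with two binary operations such that $(S,+)$ and $(S,\circ)$ are inverse semigroups and, for all $a,b,c\in S$, $a\circ(b+c)=a\circ b-a+a\circ c$ and $a\circ a^-=-a+a$, where $-a$ and $a^-$ denote the inverses of $a$ in $(S,+)$ and $(S,\circ)$, respectively; $\circ$ binds more tightly than $+$ and $-$, and $x-y$ means $x+(-y)$. In any weak brace $(S,+)$ is a Clifford semigroup. A weak brace is a dual weak brace if $(S,\circ)$ is a Clifford semigroup, and it is two-sided if $(a+b)\circ c=a\circ c-c+b\circ c$ for all its elements $a,b,c$. The (right) distributor of $S$ is $\mathcal{D}_r(S)=\{z\in S\mid \forall a,b\in S\ \ (a+b)\circ z=a\circ z-z+b\circ z\}$. A dual weak subbrace of $S$ is a subset that is an inverse subsemigroup (subsemigroup closed under inverses) of both $(S,+)$ and $(S,\circ)$, hence a dual weak brace under the restricted operations. *)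

theory Defs
  imports Main
begin

text \<open>
  Structures live on an explicit carrier set \<open>S\<close> rather than on a whole type, because the
  distributor is a subset carrying the restricted operations.  As usual for semigroups,
  carriers are non-empty; in particular a subsemigroup is non-empty.
\<close>

definition is_inverse :: "'a set \<Rightarrow> ('a \<Rightarrow> 'a \<Rightarrow> 'a) \<Rightarrow> 'a \<Rightarrow> 'a \<Rightarrow> bool" where
  "is_inverse S f a x \<longleftrightarrow> x \<in> S \<and> a = f (f a x) a \<and> x = f (f x a) x"

definition inverse_in :: "'a set \<Rightarrow> ('a \<Rightarrow> 'a \<Rightarrow> 'a) \<Rightarrow> 'a \<Rightarrow> 'a" where
  "inverse_in S f a = (THE x. is_inverse S f a x)"

locale inverse_semigroup =
  fixes S :: "'a set" and f :: "'a \<Rightarrow> 'a \<Rightarrow> 'a"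
  assumes nonempty: "S \<noteq> {}"
    and closed: "\<lbrakk>a \<in> S; b \<in> S\<rbrakk> \<Longrightarrow> f a b \<in> S"
    and assoc: "\<lbrakk>a \<in> S; b \<in> S; c \<in> S\<rbrakk> \<Longrightarrow> f (f a b) c = f a (f b c)"
    and unique_inverse: "a \<in> S \<Longrightarrow> \<exists>!x. is_inverse S f a x"

locale clifford_semigroup = inverse_semigroup +
  assumes inverse_commutes: "a \<in> S \<Longrightarrow> f a (inverse_in S f a) = f (inverse_in S f a) a"

locale weak_brace =
  additive: inverse_semigroup S add + multiplicative: inverse_semigroup S circ
  for S :: "'a set"
    and add :: "'a \<Rightarrow> 'a \<Rightarrow> 'a" (infixl \<open>\<oplus>\<close> 65)
    and circ :: "'a \<Rightarrow> 'a \<Rightarrow> 'a" (infixl \<open>\<odot>\<close> 70) +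
  assumes left_distrib: "\<lbrakk>a \<in> S; b \<in> S; c \<in> S\<rbrakk> \<Longrightarrow>
      a \<odot> (b \<oplus> c) = a \<odot> b \<oplus> inverse_in S (\<oplus>) a \<oplus> a \<odot> c"
    and circ_inverse: "a \<in> S \<Longrightarrow>
      a \<odot> inverse_in S (\<odot>) a = inverse_in S (\<oplus>) a \<oplus> a"

locale dual_weak_brace = weak_brace S add circ + multiplicative: clifford_semigroup S circ
  for S :: "'a set"
    and add :: "'a \<Rightarrow> 'a \<Rightarrow> 'a" (infixl \<open>\<oplus>\<close> 65)
    and circ :: "'a \<Rightarrow> 'a \<Rightarrow> 'a" (infixl \<open>\<odot>\<close> 70)

locale two_sided_weak_brace = weak_brace S add circ
  for S :: "'a set"
    and add :: "'a \<Rightarrow> 'a \<Rightarrow> 'a" (infixl \<open>\<oplus>\<close> 65)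
    and circ :: "'a \<Rightarrow> 'a \<Rightarrow> 'a" (infixl \<open>\<odot>\<close> 70) +
  assumes right_distrib: "\<lbrakk>a \<in> S; b \<in> S; c \<in> S\<rbrakk> \<Longrightarrow>
      (a \<oplus> b) \<odot> c = a \<odot> c \<oplus> inverse_in S (\<oplus>) c \<oplus> b \<odot> c"

definition right_distributor ::
  "'a set \<Rightarrow> ('a \<Rightarrow> 'a \<Rightarrow> 'a) \<Rightarrow> ('a \<Rightarrow> 'a \<Rightarrow> 'a) \<Rightarrow> 'a set" where
  "right_distributor S add circ =
    {z \<in> S. \<forall>a\<in>S. \<forall>b\<in>S.
      circ (add a b) z = add (add (circ a z) (inverse_in S add z)) (circ b z)}"

definition inverse_subsemigroup :: "'a set \<Rightarrow> 'a set \<Rightarrow> ('a \<Rightarrow> 'a \<Rightarrow> 'a) \<Rightarrow> bool" where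
  "inverse_subsemigroup T S f \<longleftrightarrow>
    T \<noteq> {} \<and> T \<subseteq> S \<and> (\<forall>a\<in>T. \<forall>b\<in>T. f a b \<in> T) \<and> (\<forall>a\<in>T. inverse_in S f a \<in> T)"

definition dual_weak_subbrace ::
  "'a set \<Rightarrow> 'a set \<Rightarrow> ('a \<Rightarrow> 'a \<Rightarrow> 'a) \<Rightarrow> ('a \<Rightarrow> 'a \<Rightarrow> 'a) \<Rightarrow> bool" where
  "dual_weak_subbrace T S add circ \<longleftrightarrow>
    inverse_subsemigroup T S add \<and> inverse_subsemigroup T S circ"

context inverse_semigroup
begin

lemma is_inverse_inverse_in: "a \<in> S \<Longrightarrow> is_inverse S f a (inverse_in S f a)"
  unfolding inverse_in_def by (rule theI') (rule unique_inverse)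

lemma is_inverse_sub_iff:
  assumes "inverse_subsemigroup T S f" "a \<in> T"
  shows "is_inverse T f a x \<longleftrightarrow> x = inverse_in S f a"
proof
  have a: "a \<in> S" and T: "T \<subseteq> S" "inverse_in S f a \<in> T"
    using assms by (auto simp: inverse_subsemigroup_def)
  show "x = inverse_in S f a" if "is_inverse T f a x"
  proof -
    have "is_inverse S f a x" using that T by (auto simp: is_inverse_def)
    then show ?thesis using unique_inverse[OF a] is_inverse_inverse_in[OF a] by blast
  qed
  show "is_inverse T f a x" if "x = inverse_in S f a"
    using that is_inverse_inverse_in[OF a] T by (simp add: is_inverse_def)
qed

lemma inverse_in_sub:
  assumes "inverse_subsemigroup T S f" "a \<in> T"
  shows "inverse_in T f a = inverse_in S f a"
  unfolding inverse_in_def[of T] by (rule the_equality) (simp_all add: is_inverse_sub_iff[OF assms])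

lemma inverse_semigroup_sub:
  assumes "inverse_subsemigroup T S f"
  shows "inverse_semigroup T f"
proof
  show "T \<noteq> {}" using assms by (simp add: inverse_subsemigroup_def)
  show "f a b \<in> T" if "a \<in> T" "b \<in> T" for a b
    using assms that by (simp add: inverse_subsemigroup_def)
  show "f (f a b) c = f a (f b c)" if "a \<in> T" "b \<in> T" "c \<in> T" for a b c
    using assms that assoc by (auto simp: inverse_subsemigroup_def)
  show "\<exists>!x. is_inverse T f a x" if "a \<in> T" for a
    using is_inverse_sub_iff[OF assms that] by simp
qed

end

lemma (in dual_weak_brace) dual_weak_brace_sub:
  assumes "dual_weak_subbrace T S add circ"
  shows "dual_weak_brace T add circ"
proof -
  have sub: "inverse_subsemigroup T S add" "inverse_subsemigroup T S circ"
    using assms by (simp_all add: dual_weak_subbrace_def)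
  have TS: "a \<in> S" if "a \<in> T" for a
    using that sub by (auto simp: inverse_subsemigroup_def)
  interpret Ta: inverse_semigroup T add by (rule additive.inverse_semigroup_sub[OF sub(1)])
  interpret Tm: inverse_semigroup T circ by (rule multiplicative.inverse_semigroup_sub[OF sub(2)])
  show ?thesis
    by unfold_locales
      (simp_all add: TS additive.inverse_in_sub[OF sub(1)] multiplicative.inverse_in_sub[OF sub(2)]
        left_distrib circ_inverse[symmetric] multiplicative.inverse_commutes)
qed

end

theory Submission imports Defs begin

text \<open>
  Write \<open>0\<^sub>a = a - a\<close>.  The additive and the multiplicative idempotents of \<open>S\<close> coincide,
  \<open>a \<circ> e = a + e = e \<circ> a\<close> for every idempotent \<open>e\<close>, and \<open>0\<^sub>a\<^sub>\<circ>\<^sub>b = 0\<^sub>a + 0\<^sub>b\<close>.  Hence the domain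
  idempotents can be tracked as in a strong semilattice of groups, and the usual computations in
  a brace go through: \<open>a \<circ> (-z) = a + a - a \<circ> z\<close> gives closure under negation, and for \<open>w\<close> in the
  distributor \<open>-w + (-z) \<circ> w - w = -(z \<circ> w)\<close> gives closure under products and inverses.
\<close>

section \<open>Inverse semigroups: commuting idempotents and inverses of products\<close>

context inverse_semigroup
begin

notation f (infixl \<open>\<cdot>\<close> 70)

abbreviation inv :: "'a \<Rightarrow> 'a" where "inv a \<equiv> inverse_in S f a"

lemma inv_closed [simp]: "a \<in> S \<Longrightarrow> inv a \<in> S"
  using is_inverse_inverse_in by (simp add: is_inverse_def)

lemma mult_inv_mult: "a \<in> S \<Longrightarrow> a \<cdot> (inv a \<cdot> a) = a"
  using is_inverse_inverse_in[of a] by (simp add: is_inverse_def assoc)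

lemma inv_mult_inv: "a \<in> S \<Longrightarrow> inv a \<cdot> (a \<cdot> inv a) = inv a"
  using is_inverse_inverse_in[of a] by (simp add: is_inverse_def assoc)

lemma inv_eqI:
  assumes "a \<in> S" "x \<in> S" "a \<cdot> (x \<cdot> a) = a" "x \<cdot> (a \<cdot> x) = x"
  shows "inv a = x"
proof -
  have "is_inverse S f a x" using assms by (simp add: is_inverse_def assoc)
  then show ?thesis using unique_inverse is_inverse_inverse_in assms(1) by blast
qed

lemma inv_inv: "a \<in> S \<Longrightarrow> inv (inv a) = a"
  by (rule inv_eqI) (simp_all add: mult_inv_mult inv_mult_inv)

lemma inv_idem: "\<lbrakk>e \<in> S; e \<cdot> e = e\<rbrakk> \<Longrightarrow> inv e = e"
  by (rule inv_eqI) simp_all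

text \<open>Uniqueness of inverses does the work: the inverse \<open>x\<close> of
  \<open>e \<cdot> g\<close> turns out to be idempotent, hence self-inverse, so that
  \<open>e \<cdot> g = inv x = x\<close>.\<close>

lemma idem_mult_idem:
  assumes e: "e \<in> S" "e \<cdot> e = e" and g: "g \<in> S" "g \<cdot> g = g"
  shows "(e \<cdot> g) \<cdot> (e \<cdot> g) = e \<cdot> g"
proof -
  note c = closed assoc
  define x where "x = inv (e \<cdot> g)"
  have x: "x \<in> S" using e g by (simp add: x_def closed)
  have ee: "e \<cdot> (e \<cdot> y) = e \<cdot> y" and gg: "g \<cdot> (g \<cdot> y) = g \<cdot> y" if "y \<in> S" for y
    using that e g by (metis assoc)+
  have 1: "e \<cdot> (g \<cdot> (x \<cdot> (e \<cdot> g))) = e \<cdot> g"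
    using mult_inv_mult[of "e \<cdot> g"] e g x by (simp add: x_def[symmetric] c)
  have 2: "x \<cdot> (e \<cdot> (g \<cdot> x)) = x"
    using inv_mult_inv[of "e \<cdot> g"] e g x by (simp add: x_def[symmetric] c)
  have 3: "x \<cdot> (e \<cdot> (g \<cdot> (x \<cdot> y))) = x \<cdot> y" if "y \<in> S" for y
    using arg_cong[OF 2, of "\<lambda>u. u \<cdot> y"] that e g x by (simp add: c)
  \<comment> \<open>The outer factors \<open>g\<close> and \<open>e\<close> are absorbed next to
    \<open>e \<cdot> g\<close>, so this element is a second inverse of \<open>e \<cdot> g\<close>
    and must coincide with \<open>x\<close>.\<close>
  have "inv (e \<cdot> g) = g \<cdot> (x \<cdot> e)"
    by (rule inv_eqI) (use e g x in \<open>simp_all add: c ee gg 1 3\<close>)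
  then have xe: "g \<cdot> (x \<cdot> e) = x" by (simp add: x_def)
  have "x \<cdot> x = (g \<cdot> (x \<cdot> e)) \<cdot> (g \<cdot> (x \<cdot> e))" by (simp add: xe)
  also have "\<dots> = g \<cdot> (x \<cdot> e)" using e g x by (simp add: c 3)
  also have "\<dots> = x" by (rule xe)
  finally have xx: "x \<cdot> x = x" .
  have "e \<cdot> g = inv x" using e g by (simp add: x_def inv_inv closed)
  then have "e \<cdot> g = x" using x xx inv_idem by simp
  then show ?thesis using xx by simp
qed

text \<open>Both \<open>g \<cdot> e\<close> and the idempotent \<open>e \<cdot> g\<close> itself are
  inverses of \<open>e \<cdot> g\<close>.\<close>

lemma idem_commute:
  assumes e: "e \<in> S" "e \<cdot> e = e" and g: "g \<in> S" "g \<cdot> g = g"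
  shows "e \<cdot> g = g \<cdot> e"
proof -
  note c = closed assoc
  have ee: "e \<cdot> (e \<cdot> y) = e \<cdot> y" and gg: "g \<cdot> (g \<cdot> y) = g \<cdot> y" if "y \<in> S" for y
    using that e g by (metis assoc)+
  have eg: "e \<cdot> (g \<cdot> (e \<cdot> g)) = e \<cdot> g" "g \<cdot> (e \<cdot> (g \<cdot> e)) = g \<cdot> e"
    using idem_mult_idem[OF e g] idem_mult_idem[OF g e] e g by (simp_all add: c)
  have "inv (e \<cdot> g) = g \<cdot> e"
    by (rule inv_eqI) (use e g in \<open>simp_all add: c ee gg eg\<close>)
  moreover have "inv (e \<cdot> g) = e \<cdot> g"
    by (rule inv_idem) (use e g in \<open>simp_all add: c eg\<close>)
  ultimately show ?thesis by simp
qed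

lemma mult_inv_idem: "a \<in> S \<Longrightarrow> (a \<cdot> inv a) \<cdot> (a \<cdot> inv a) = a \<cdot> inv a"
  by (simp add: closed assoc inv_mult_inv)

lemma inv_mult_idem: "a \<in> S \<Longrightarrow> (inv a \<cdot> a) \<cdot> (inv a \<cdot> a) = inv a \<cdot> a"
  by (simp add: closed assoc mult_inv_mult)

text \<open>In \<open>a \<cdot> b \<cdot> inv b \<cdot> inv a \<cdot> a \<cdot> b\<close> the two
  inner idempotents \<open>b \<cdot> inv b\<close> and \<open>inv a \<cdot> a\<close> can be
  swapped, after which each is absorbed by its neighbour.\<close>

lemma inv_mult:
  assumes a: "a \<in> S" and b: "b \<in> S"
  shows "inv (a \<cdot> b) = inv b \<cdot> inv a"
proof (rule inv_eqI)
  note c = closed assoc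
  have comm: "(inv a \<cdot> a) \<cdot> (b \<cdot> inv b) = (b \<cdot> inv b) \<cdot> (inv a \<cdot> a)"
    by (rule idem_commute) (use a b in \<open>simp_all add: closed mult_inv_idem inv_mult_idem\<close>)
  have "a \<cdot> b \<cdot> (inv b \<cdot> inv a \<cdot> (a \<cdot> b)) = a \<cdot> ((b \<cdot> inv b) \<cdot> (inv a \<cdot> a)) \<cdot> b"
    using a b by (simp add: c)
  also have "\<dots> = (a \<cdot> (inv a \<cdot> a)) \<cdot> (b \<cdot> (inv b \<cdot> b))"
    using a b unfolding comm[symmetric] by (simp add: c)
  finally show "a \<cdot> b \<cdot> (inv b \<cdot> inv a \<cdot> (a \<cdot> b)) = a \<cdot> b"
    using a b by (simp add: mult_inv_mult)
  have "inv b \<cdot> inv a \<cdot> (a \<cdot> b \<cdot> (inv b \<cdot> inv a))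
      = inv b \<cdot> ((inv a \<cdot> a) \<cdot> (b \<cdot> inv b)) \<cdot> inv a"
    using a b by (simp add: c)
  also have "\<dots> = (inv b \<cdot> (b \<cdot> inv b)) \<cdot> (inv a \<cdot> (a \<cdot> inv a))"
    using a b unfolding comm by (simp add: c)
  finally show "inv b \<cdot> inv a \<cdot> (a \<cdot> b \<cdot> (inv b \<cdot> inv a)) = inv b \<cdot> inv a"
    using a b by (simp add: inv_mult_inv)
qed (use a b in \<open>simp_all add: closed\<close>)

end

section \<open>Centrality of idempotents in Clifford semigroups\<close>

lemma (in clifford_semigroup) idem_central:
  assumes e: "e \<in> S" "e \<cdot> e = e" and a: "a \<in> S"
  shows "e \<cdot> a = a \<cdot> e"
proof -
  note c = closed assoc
  have ie: "inv e = e" using e by (rule inv_idem)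
  have comm: "a \<cdot> (inv a \<cdot> e) = e \<cdot> (a \<cdot> inv a)"
    using idem_commute[OF e, of "a \<cdot> inv a"] e a by (simp add: c mult_inv_idem inv_mult_inv)
  have ee: "e \<cdot> (e \<cdot> y) = e \<cdot> y" if "y \<in> S" for y
    using that e by (metis assoc)
  have comm': "a \<cdot> (inv a \<cdot> (e \<cdot> y)) = e \<cdot> (a \<cdot> (inv a \<cdot> y))" if "y \<in> S" for y
    using arg_cong[OF comm, of "\<lambda>u. u \<cdot> y"] that e a by (simp add: c)
  \<comment> \<open>The Clifford law for \<open>e \<cdot> a\<close>. Multiplied by \<open>a\<close>
    on the left, its right side collapses to \<open>e \<cdot> a\<close> and its left side to
    \<open>a \<cdot> e\<close>.\<close>
  have "e \<cdot> (a \<cdot> inv a) = inv a \<cdot> (e \<cdot> a)"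
    using inverse_commutes[of "e \<cdot> a"] e a by (simp add: inv_mult ie c ee comm)
  then have "a \<cdot> (e \<cdot> (a \<cdot> inv a)) = a \<cdot> (inv a \<cdot> (e \<cdot> a))" by simp
  also have "\<dots> = e \<cdot> (a \<cdot> (inv a \<cdot> a))" using comm' a by simp
  also have "\<dots> = e \<cdot> a" using a by (simp add: mult_inv_mult)
  finally have "e \<cdot> a = a \<cdot> (e \<cdot> (a \<cdot> inv a))" by simp
  also have "\<dots> = (a \<cdot> (inv a \<cdot> a)) \<cdot> e"
    using e a by (simp add: c comm[symmetric] inverse_commutes[symmetric])
  also have "\<dots> = a \<cdot> e" using a by (simp add: mult_inv_mult)
  finally show ?thesis .
qed

section \<open>Dual weak braces with commutative addition: additive arithmetic\<close>

locale comm_dual_weak_brace = dual_weak_brace S add circ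
  for S :: "'a set"
    and add :: "'a \<Rightarrow> 'a \<Rightarrow> 'a" (infixl \<open>\<oplus>\<close> 65)
    and circ :: "'a \<Rightarrow> 'a \<Rightarrow> 'a" (infixl \<open>\<odot>\<close> 70) +
  assumes add_commute: "\<lbrakk>a \<in> S; b \<in> S\<rbrakk> \<Longrightarrow> a \<oplus> b = b \<oplus> a"
begin

abbreviation neg :: "'a \<Rightarrow> 'a"  (\<open>\<ominus> _\<close> [81] 80) where "\<ominus> a \<equiv> inverse_in S (\<oplus>) a"

abbreviation rec :: "'a \<Rightarrow> 'a" where "rec a \<equiv> inverse_in S (\<odot>) a"

text \<open>The identity of the maximal additive subgroup containing \<open>a\<close>; it varies
  with \<open>a\<close>, so every cancellation leaves such an idempotent behind.\<close>

abbreviation zero :: "'a \<Rightarrow> 'a" where "zero a \<equiv> a \<oplus> \<ominus> a"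

lemmas add_closed [simp] = additive.closed
lemmas circ_closed [simp] = multiplicative.closed
lemmas add_assoc = additive.assoc
lemmas circ_assoc = multiplicative.assoc
lemmas neg_neg = additive.inv_inv

lemma add_left_commute: "\<lbrakk>a \<in> S; b \<in> S; c \<in> S\<rbrakk> \<Longrightarrow> a \<oplus> (b \<oplus> c) = b \<oplus> (a \<oplus> c)"
  by (metis add_assoc add_commute)

lemmas add_ac = add_assoc add_commute add_left_commute

lemma neg_add: "\<lbrakk>a \<in> S; b \<in> S\<rbrakk> \<Longrightarrow> \<ominus> (a \<oplus> b) = \<ominus> a \<oplus> \<ominus> b"
  by (simp add: additive.inv_mult add_commute)

text \<open>Links the two structures: the local identity of \<open>a\<close> is the same for both
  operations.\<close>

lemma circ_rec: "a \<in> S \<Longrightarrow> a \<odot> rec a = zero a"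
  by (simp add: circ_inverse add_commute)

lemma rec_circ: "a \<in> S \<Longrightarrow> rec a \<odot> a = zero a"
  by (simp add: circ_rec flip: multiplicative.inverse_commutes)

lemma zero_idem: "a \<in> S \<Longrightarrow> zero a \<oplus> zero a = zero a"
  by (rule additive.mult_inv_idem)

lemma add_zero: "a \<in> S \<Longrightarrow> a \<oplus> zero a = a"
  using additive.mult_inv_mult[of a] by (simp add: add_ac)

lemma idem_zero: "\<lbrakk>e \<in> S; e \<oplus> e = e\<rbrakk> \<Longrightarrow> zero e = e"
  by (simp add: additive.inv_idem)

section \<open>Idempotents common to both operations\<close>

lemma zero_circ_idem: "a \<in> S \<Longrightarrow> zero a \<odot> zero a = zero a"
  using multiplicative.mult_inv_idem[of a] by (simp add: circ_rec)

lemma idem_circ_idem: "\<lbrakk>e \<in> S; e \<oplus> e = e\<rbrakk> \<Longrightarrow> e \<odot> e = e"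
  using zero_circ_idem[of e] by (simp add: idem_zero)

text \<open>A multiplicative idempotent is its own reciprocal, so
  \<open>e = e \<odot> rec e = zero e\<close>.\<close>

lemma circ_idem_idem: "\<lbrakk>e \<in> S; e \<odot> e = e\<rbrakk> \<Longrightarrow> e \<oplus> e = e"
  using zero_idem[of e] circ_rec[of e] by (simp add: multiplicative.inv_idem)

lemma idem_circ_eq_add_idem:
  assumes e: "e \<in> S" "e \<oplus> e = e" and g: "g \<in> S" "g \<oplus> g = g"
  shows "e \<odot> g = e \<oplus> g"
proof -
  \<comment> \<open>Obtained by expanding \<open>x \<odot> (y \<oplus> y)\<close>, since
    \<open>x \<odot> y\<close> is again an additive idempotent.\<close>
  have absorb: "x \<odot> y = x \<oplus> x \<odot> y" if x: "x \<in> S" "x \<oplus> x = x" and y: "y \<in> S" "y \<oplus> y = y" for x y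
  proof -
    have idem: "x \<odot> y \<oplus> x \<odot> y = x \<odot> y"
      using x y by (intro circ_idem_idem multiplicative.idem_mult_idem)
        (simp_all add: idem_circ_idem)
    have "x \<odot> y = x \<odot> y \<oplus> x \<oplus> x \<odot> y"
      using left_distrib[of x y y] x y by (simp add: additive.inv_idem)
    then have "x \<odot> y = x \<oplus> (x \<odot> y \<oplus> x \<odot> y)" using x y by (simp add: add_ac)
    then show ?thesis by (simp add: idem)
  qed
  have comm: "g \<odot> e = e \<odot> g"
    using e g by (intro multiplicative.idem_commute) (simp_all add: idem_circ_idem)
  define h where "h = e \<oplus> g"
  have h: "h \<in> S" "h \<oplus> h = h" "\<ominus> h = h"
  proof -
    show 1: "h \<in> S" using e g by (simp add: h_def)
    have "h \<oplus> h = (e \<oplus> e) \<oplus> (g \<oplus> g)" using e(1) g(1) by (simp add: h_def add_ac)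
    then show 2: "h \<oplus> h = h" by (simp add: e g h_def)
    show "\<ominus> h = h" using 1 2 by (rule additive.inv_idem)
  qed
  have ge: "g \<oplus> e \<odot> g = e \<odot> g" using absorb[OF g e] by (simp add: comm)
  have eh: "e \<odot> h = e \<odot> g"
    using e g left_distrib[of e e g] absorb[OF e g]
    by (simp add: h_def additive.inv_idem idem_circ_idem)
  have gh: "g \<odot> h = e \<odot> g"
    using e g left_distrib[of g e g] ge
    by (simp add: h_def additive.inv_idem idem_circ_idem comm add_ac)
  have "h \<odot> e = e \<odot> g" "h \<odot> g = e \<odot> g"
    using eh gh e g h by (metis multiplicative.idem_commute idem_circ_idem)+
  \<comment> \<open>This expands \<open>h = h \<odot> h = h \<odot> (e \<oplus> g)\<close>. As
    \<open>e \<odot> g\<close> absorbs both \<open>e\<close> and \<open>g\<close>, the middle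
    \<open>h\<close> then disappears.\<close>
  then have "h = e \<odot> g \<oplus> h \<oplus> e \<odot> g"
    using left_distrib[of h e g] e g h idem_circ_idem[of h] by (simp add: h_def)
  also have "\<dots> = e \<odot> g \<oplus> (e \<oplus> (g \<oplus> e \<odot> g))"
    using e g by (simp add: h_def add_ac)
  also have "\<dots> = e \<odot> g \<oplus> e \<odot> g"
    using absorb[OF e g] by (simp add: ge)
  also have "\<dots> = e \<odot> g"
    using e g by (intro circ_idem_idem multiplicative.idem_mult_idem) (simp_all add: idem_circ_idem)
  finally show ?thesis by (simp add: h_def)
qed

section \<open>Local identities of products, sums and inverses\<close>

lemma circ_idem_comm: "\<lbrakk>e \<in> S; e \<oplus> e = e; a \<in> S\<rbrakk> \<Longrightarrow> e \<odot> a = a \<odot> e"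
  by (rule multiplicative.idem_central) (simp_all add: idem_circ_idem)

text \<open>The local identity of \<open>a \<odot> b\<close> is
  \<open>a \<odot> b \<odot> rec b \<odot> rec a\<close>; the inner \<open>zero b\<close> is central
  and moves out, leaving a product of idempotents, which equals their sum.\<close>

lemma zero_circ:
  assumes a: "a \<in> S" and b: "b \<in> S"
  shows "zero (a \<odot> b) = zero a \<oplus> zero b"
proof -
  have "zero (a \<odot> b) = a \<odot> (zero b \<odot> rec a)"
    using a b by (simp add: multiplicative.inv_mult circ_assoc flip: circ_rec)
  also have "\<dots> = zero a \<odot> zero b"
    using a b circ_idem_comm[of "zero b" "rec a"]
    by (simp add: zero_idem circ_rec flip: circ_assoc)
  also have "\<dots> = zero a \<oplus> zero b"
    using a b by (intro idem_circ_eq_add_idem) (simp_all add: zero_idem)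
  finally show ?thesis .
qed

lemma zero_add: "\<lbrakk>a \<in> S; b \<in> S\<rbrakk> \<Longrightarrow> zero (a \<oplus> b) = zero a \<oplus> zero b"
  by (simp add: neg_add add_ac)

lemma zero_neg: "a \<in> S \<Longrightarrow> zero (\<ominus> a) = zero a"
  by (simp add: neg_neg add_commute)

lemma zero_rec: "a \<in> S \<Longrightarrow> zero (rec a) = zero a"
  using circ_rec[of "rec a"] by (simp add: multiplicative.inv_inv rec_circ)

text \<open>\<open>zero a\<close> is a summand of \<open>zero (a \<odot> b)\<close>, which
  \<open>a \<odot> b\<close> absorbs. This and its right-hand companion remove the idempotents left
  by cancellation.\<close>

lemma circ_absorb_left:
  assumes "a \<in> S" "b \<in> S"
  shows "zero a \<oplus> a \<odot> b = a \<odot> b"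
proof -
  have "zero a \<oplus> a \<odot> b = zero a \<oplus> (a \<odot> b \<oplus> (zero a \<oplus> zero b))"
    using assms add_zero[of "a \<odot> b"] by (simp add: zero_circ)
  also have "\<dots> = a \<odot> b \<oplus> ((zero a \<oplus> zero a) \<oplus> zero b)"
    using assms by (simp only: add_ac add_closed additive.inv_closed circ_closed)
  also have "\<dots> = a \<odot> b \<oplus> zero (a \<odot> b)"
    using assms by (simp only: zero_idem zero_circ)
  finally show ?thesis using assms by (simp add: add_zero)
qed

lemma circ_absorb_right:
  assumes "a \<in> S" "b \<in> S"
  shows "zero b \<oplus> a \<odot> b = a \<odot> b"
proof -
  have "zero b \<oplus> a \<odot> b = zero b \<oplus> (a \<odot> b \<oplus> (zero a \<oplus> zero b))"
    using assms add_zero[of "a \<odot> b"] by (simp add: zero_circ)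
  also have "\<dots> = a \<odot> b \<oplus> (zero a \<oplus> (zero b \<oplus> zero b))"
    using assms by (simp only: add_ac add_closed additive.inv_closed circ_closed)
  also have "\<dots> = a \<odot> b \<oplus> zero (a \<odot> b)"
    using assms by (simp only: zero_idem zero_circ)
  finally show ?thesis using assms by (simp add: add_zero)
qed

text \<open>
  With \<open>h = -a + a \<circ> e\<close>, distributivity on \<open>e + e\<close> makes \<open>h\<close> idempotent, so that
  \<open>h = 0\<^sub>a + h = 0\<^bsub>a \<circ> e\<^esub> = 0\<^sub>a + e\<close>.
\<close>

lemma circ_idem:
  assumes a: "a \<in> S" and e: "e \<in> S" "e \<oplus> e = e"
  shows "a \<odot> e = a \<oplus> e"
proof -
  define h where "h = \<ominus> a \<oplus> a \<odot> e"
  have hS: "h \<in> S" using a e by (simp add: h_def)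
  have ah: "a \<oplus> h = a \<odot> e"
    using a e circ_absorb_left[of a e] by (simp add: h_def add_assoc)
  have "a \<odot> e = a \<odot> e \<oplus> \<ominus> a \<oplus> a \<odot> e"
    using left_distrib[of a e e] a e by simp
  then have "h = \<ominus> a \<oplus> (a \<odot> e \<oplus> \<ominus> a \<oplus> a \<odot> e)" by (simp add: h_def)
  also have "\<dots> = h \<oplus> h" using a e by (simp add: h_def add_assoc)
  finally have hh: "h \<oplus> h = h" by simp
  have "zero a \<oplus> h = h"
    using a e additive.inv_mult_inv[of a] by (simp add: h_def add_ac)
  moreover have "zero a \<oplus> h = zero a \<oplus> e"
    using zero_add[OF a hS] zero_circ[OF a e(1)] by (simp add: ah idem_zero hS hh e)
  ultimately have "h = zero a \<oplus> e" by simp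
  then have "a \<odot> e = a \<oplus> zero a \<oplus> e" using a e ah by (simp add: add_assoc)
  then show ?thesis using a by (simp add: add_zero)
qed

section \<open>Closure properties of the right distributor\<close>

abbreviation D :: "'a set" where "D \<equiv> right_distributor S (\<oplus>) (\<odot>)"

lemma D_carrier: "z \<in> D \<Longrightarrow> z \<in> S"
  by (simp add: right_distributor_def)

lemma D_distrib:
  "\<lbrakk>z \<in> D; a \<in> S; b \<in> S\<rbrakk> \<Longrightarrow> (a \<oplus> b) \<odot> z = a \<odot> z \<oplus> \<ominus> z \<oplus> b \<odot> z"
  by (simp add: right_distributor_def)

lemma D_I:
  assumes "z \<in> S"
    and "\<And>a b. \<lbrakk>a \<in> S; b \<in> S\<rbrakk> \<Longrightarrow> (a \<oplus> b) \<odot> z = a \<odot> z \<oplus> \<ominus> z \<oplus> b \<odot> z"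
  shows "z \<in> D"
  using assms by (simp add: right_distributor_def)

text \<open>Multiplication by \<open>e\<close> is addition of \<open>e\<close>, so both sides become
  \<open>a \<oplus> b \<oplus> e\<close>. This supplies an element of the distributor.\<close>

lemma idem_in_D:
  assumes e: "e \<in> S" "e \<oplus> e = e"
  shows "e \<in> D"
proof (rule D_I)
  fix a b assume ab: "a \<in> S" "b \<in> S"
  have ee: "e \<oplus> (e \<oplus> x) = e \<oplus> x" if "x \<in> S" for x
    using that e by (metis add_assoc)
  show "(a \<oplus> b) \<odot> e = a \<odot> e \<oplus> \<ominus> e \<oplus> b \<odot> e"
    using ab e by (simp add: circ_idem additive.inv_idem add_ac ee)
qed (use e in simp)

text \<open>Left distributivity over \<open>z \<oplus> w\<close> followed by right distributivity at
  \<open>z\<close> and \<open>w\<close> gives the same summands on both sides; commutativity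
  regroups them.\<close>

lemma D_add_closed:
  assumes z: "z \<in> D" and w: "w \<in> D"
  shows "z \<oplus> w \<in> D"
proof (rule D_I)
  fix a b assume ab: "a \<in> S" "b \<in> S"
  show "(a \<oplus> b) \<odot> (z \<oplus> w) = a \<odot> (z \<oplus> w) \<oplus> \<ominus> (z \<oplus> w) \<oplus> b \<odot> (z \<oplus> w)"
    using ab D_carrier[OF z] D_carrier[OF w]
    by (simp add: left_distrib D_distrib[OF z] D_distrib[OF w] neg_add add_ac)
qed (use D_carrier[OF z] D_carrier[OF w] in simp)

lemma circ_neg:
  assumes a: "a \<in> S" and z: "z \<in> S"
  shows "a \<odot> \<ominus> z = a \<oplus> a \<oplus> \<ominus> (a \<odot> z)"
proof -
  define y where "y = a \<odot> \<ominus> z"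
  have y: "y \<in> S" and az: "a \<odot> z \<in> S" using a z by (simp_all add: y_def)
  have zy: "zero a \<oplus> zero z \<oplus> y = y"
    using a z circ_absorb_left[of a "\<ominus> z"] circ_absorb_right[of a "\<ominus> z"]
    by (simp add: y_def zero_neg add_assoc)
  \<comment> \<open>Two evaluations of \<open>a \<odot> (z \<oplus> \<ominus> z)\<close>; the rest
    solves for \<open>y\<close>, which by \<open>zy\<close> absorbs the idempotents that
    arise.\<close>
  have "a \<oplus> zero z = a \<odot> z \<oplus> \<ominus> a \<oplus> y"
    using left_distrib[of a z "\<ominus> z"] circ_idem[of a "zero z"] a z
    by (simp add: y_def zero_idem)
  then have "a \<oplus> (a \<oplus> zero z) \<oplus> \<ominus> (a \<odot> z) = a \<oplus> (a \<odot> z \<oplus> \<ominus> a \<oplus> y) \<oplus> \<ominus> (a \<odot> z)"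
    by simp
  also have "\<dots> = zero a \<oplus> zero (a \<odot> z) \<oplus> y"
    using a az y by (simp only: add_ac add_closed additive.inv_closed)
  also have "\<dots> = (zero a \<oplus> zero a) \<oplus> zero z \<oplus> y"
    using a z y by (simp only: zero_circ add_assoc add_closed additive.inv_closed)
  also have "\<dots> = y" using a z y zy by (simp only: zero_idem)
  finally have "y = a \<oplus> (a \<oplus> zero z) \<oplus> \<ominus> (a \<odot> z)" by simp
  also have "\<dots> = a \<oplus> a \<oplus> (zero (\<ominus> z) \<oplus> \<ominus> (a \<odot> z))"
    using a z by (simp add: add_assoc zero_neg)
  also have "zero (\<ominus> z) \<oplus> \<ominus> (a \<odot> z) = \<ominus> (zero z \<oplus> a \<odot> z)"
    using a z by (simp add: neg_add)
  also have "\<dots> = \<ominus> (a \<odot> z)" using a z by (simp add: circ_absorb_right)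
  finally show ?thesis by (simp add: y_def)
qed

lemma D_neg_closed:
  assumes z: "z \<in> D"
  shows "\<ominus> z \<in> D"
proof (rule D_I)
  fix a b assume ab: "a \<in> S" "b \<in> S"
  show "(a \<oplus> b) \<odot> \<ominus> z = a \<odot> \<ominus> z \<oplus> \<ominus> (\<ominus> z) \<oplus> b \<odot> \<ominus> z"
    using ab D_carrier[OF z]
    by (simp add: circ_neg D_distrib[OF z] neg_add neg_neg add_ac)
qed (use D_carrier[OF z] in simp)

text \<open>The right-hand counterpart of \<open>circ_neg\<close>: evaluate
  \<open>(z \<oplus> \<ominus> z) \<odot> w\<close> both as \<open>w \<oplus> zero z\<close> and by
  distributivity at \<open>w\<close>, then solve for the term with
  \<open>\<ominus> z\<close>.\<close>

lemma neg_circ_D: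
  assumes w: "w \<in> D" and z: "z \<in> S"
  shows "\<ominus> w \<oplus> (\<ominus> z) \<odot> w \<oplus> \<ominus> w = \<ominus> (z \<odot> w)"
proof -
  note wS = D_carrier[OF w]
  define p where "p = z \<odot> w"
  define q where "q = (\<ominus> z) \<odot> w"
  have pq: "p \<in> S" "q \<in> S" using z wS by (simp_all add: p_def q_def)
  have zp: "zero p = zero z \<oplus> zero w" using z wS by (simp add: p_def zero_circ)
  have zq: "zero z \<oplus> (zero w \<oplus> q) = q"
    using z wS circ_absorb_left[of "\<ominus> z" w] circ_absorb_right[of "\<ominus> z" w]
    by (simp add: q_def zero_neg)
  have "w \<oplus> zero z = p \<oplus> \<ominus> w \<oplus> q"
    using D_distrib[OF w z, of "\<ominus> z"] circ_idem[of w "zero z"] circ_idem_comm[of "zero z" w] z wS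
    by (simp add: p_def q_def zero_idem)
  then have "\<ominus> p \<oplus> \<ominus> w \<oplus> (w \<oplus> zero z) = \<ominus> p \<oplus> \<ominus> w \<oplus> (p \<oplus> \<ominus> w \<oplus> q)" by simp
  moreover have "\<ominus> p \<oplus> \<ominus> w \<oplus> (p \<oplus> \<ominus> w \<oplus> q) = \<ominus> w \<oplus> (zero p \<oplus> q) \<oplus> \<ominus> w"
    using pq wS by (simp add: add_ac)
  moreover have "\<dots> = \<ominus> w \<oplus> q \<oplus> \<ominus> w"
    using z wS pq zq by (simp add: zp add_assoc)
  moreover have "\<ominus> p \<oplus> \<ominus> w \<oplus> (w \<oplus> zero z) = \<ominus> p \<oplus> zero p"
    using z wS pq unfolding zp by (simp add: add_ac)
  moreover have "\<ominus> p \<oplus> zero p = \<ominus> p"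
    using pq additive.inv_mult_inv by simp
  ultimately show ?thesis by (simp add: p_def q_def)
qed

text \<open>Distributing twice puts \<open>\<ominus> w\<close> on either side of
  \<open>(\<ominus> z) \<odot> w\<close>, which is exactly the shape collapsed by
  \<open>neg_circ_D\<close>. This form serves both products and reciprocals.\<close>

lemma D_distrib3:
  assumes w: "w \<in> D" and "a \<in> S" "b \<in> S" "z \<in> S"
  shows "(a \<oplus> \<ominus> z \<oplus> b) \<odot> w = a \<odot> w \<oplus> \<ominus> (z \<odot> w) \<oplus> b \<odot> w"
  using assms D_carrier[OF w]
  by (simp add: D_distrib[OF w] add_assoc flip: neg_circ_D[OF w])

lemma D_circ_closed:
  assumes z: "z \<in> D" and w: "w \<in> D"
  shows "z \<odot> w \<in> D"
proof (rule D_I)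
  fix a b assume ab: "a \<in> S" "b \<in> S"
  show "(a \<oplus> b) \<odot> (z \<odot> w) = a \<odot> (z \<odot> w) \<oplus> \<ominus> (z \<odot> w) \<oplus> b \<odot> (z \<odot> w)"
    using ab D_carrier[OF z] D_carrier[OF w]
    by (simp add: D_distrib[OF z] D_distrib3[OF w] flip: circ_assoc)
qed (use D_carrier[OF z] D_carrier[OF w] in simp)

lemma D_rec_closed:
  assumes z: "z \<in> D"
  shows "rec z \<in> D"
proof (rule D_I)
  note zS = D_carrier[OF z]
  fix a b assume ab: "a \<in> S" "b \<in> S"
  \<comment> \<open>The value that \<open>(a \<oplus> b) \<odot> rec z\<close> should have. The plan
    is to compare both after multiplication by \<open>z\<close> on the right, then undo that with
    \<open>rec z\<close>.\<close>
  define X where "X = a \<odot> rec z \<oplus> \<ominus> (rec z) \<oplus> b \<odot> rec z"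
  have XS: "X \<in> S" using ab zS by (simp add: X_def)
  have circ_rec_z: "c \<odot> rec z \<odot> z = c \<oplus> zero z" if "c \<in> S" for c
    using that zS by (simp add: circ_assoc rec_circ circ_idem zero_idem)
  have zz: "\<ominus> (zero z) = zero z"
    using zS by (simp add: additive.inv_idem zero_idem)
  have ee: "zero z \<oplus> (zero z \<oplus> zero z) = zero z" using zS by (simp add: zero_idem)
  have "X \<odot> z = (a \<oplus> zero z) \<oplus> zero z \<oplus> (b \<oplus> zero z)"
    using ab zS D_distrib3[OF z, of "a \<odot> rec z" "b \<odot> rec z" "rec z"]
    by (simp only: X_def circ_rec_z rec_circ zz circ_closed multiplicative.inv_closed)
  also have "\<dots> = (a \<oplus> b) \<oplus> (zero z \<oplus> (zero z \<oplus> zero z))"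
    using ab zS by (simp only: add_ac add_closed additive.inv_closed)
  also have "\<dots> = (a \<oplus> b) \<odot> zero z"
    unfolding ee using ab zS by (simp add: circ_idem zero_idem)
  finally have "X \<odot> z \<odot> rec z = (a \<oplus> b) \<odot> zero z \<odot> rec z" by simp
  moreover have "(a \<oplus> b) \<odot> zero z \<odot> rec z = (a \<oplus> b) \<odot> rec z"
    using ab zS multiplicative.inv_mult_inv[of z]
    by (simp add: circ_assoc flip: rec_circ)
  moreover have "X \<odot> z \<odot> rec z = zero z \<oplus> X"
    using XS zS by (simp add: circ_assoc circ_rec circ_idem zero_idem add_commute)
  \<comment> \<open>Cancelling \<open>z\<close> only returns \<open>X\<close> up to
    \<open>zero z\<close>; since this is also the local identity of \<open>rec z\<close>, the first
    summand of \<open>X\<close> absorbs it.\<close>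
  moreover have "zero z \<oplus> X = (zero (rec z) \<oplus> a \<odot> rec z) \<oplus> \<ominus> (rec z) \<oplus> b \<odot> rec z"
    using ab zS by (simp add: X_def add_assoc zero_rec)
  moreover have "\<dots> = X"
    using ab zS by (simp only: circ_absorb_right X_def multiplicative.inv_closed)
  ultimately show "(a \<oplus> b) \<odot> rec z = a \<odot> rec z \<oplus> \<ominus> (rec z) \<oplus> b \<odot> rec z"
    by (simp add: X_def)
qed (use D_carrier[OF z] in simp)

lemma D_nonempty: "D \<noteq> {}"
proof -
  obtain a where "a \<in> S" using additive.nonempty by blast
  then have "zero a \<in> D" by (intro idem_in_D) (simp_all add: zero_idem)
  then show ?thesis by blast
qed

section \<open>The distributor as a two-sided dual weak subbrace\<close>

lemma D_dual_weak_subbrace: "dual_weak_subbrace D S (\<oplus>) (\<odot>)"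
  unfolding dual_weak_subbrace_def inverse_subsemigroup_def
  by (simp add: subset_iff D_nonempty D_carrier D_add_closed D_neg_closed D_circ_closed D_rec_closed)

text \<open>Negatives computed inside \<open>D\<close> agree with those of \<open>S\<close>, so the
  condition defining the distributor restricts to right distributivity on \<open>D\<close>.\<close>

lemma D_two_sided: "two_sided_weak_brace D (\<oplus>) (\<odot>)"
proof -
  interpret T: dual_weak_brace D add circ
    by (rule dual_weak_brace_sub[OF D_dual_weak_subbrace])
  have sub: "inverse_subsemigroup D S (\<oplus>)"
    using D_dual_weak_subbrace by (simp add: dual_weak_subbrace_def)
  show ?thesis
    by unfold_locales (simp add: additive.inverse_in_sub[OF sub] D_distrib D_carrier)
qed

end

theorem proposition3p2:
  fixes S :: "'a set"
    and add :: "'a \<Rightarrow> 'a \<Rightarrow> 'a"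
    and circ :: "'a \<Rightarrow> 'a \<Rightarrow> 'a"
  assumes "dual_weak_brace S add circ"
    and "\<And>a b. \<lbrakk>a \<in> S; b \<in> S\<rbrakk> \<Longrightarrow> add a b = add b a"
  shows "dual_weak_subbrace (right_distributor S add circ) S add circ
    \<and> two_sided_weak_brace (right_distributor S add circ) add circ"
proof -
  interpret comm_dual_weak_brace S add circ
    using assms by (simp add: comm_dual_weak_brace_def comm_dual_weak_brace_axioms_def)
  show ?thesis using D_dual_weak_subbrace D_two_sided by simp
qed

end
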